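(* Let $\underline{x}=(x_1,x_2)^T,\ \underline{y}=(y_1,y_2)^T\in\mathbb{F}_q((T^{-1}))^2$ with $x_2\ne0$, $y_2\neq0$, $|x_1|\le|x_2|$, $|y_1|\le|y_2|$, such that $\xi=x_1/x_2\notin\mathbb{F}_q(T)$ and $y_1/y_2\in\mathbb{F}_q(T)$. Write $y_1/y_2=A/B$ with $A,B\in\mathbb{F}_q[T]$ coprime, and let $P_k/Q_k$ be the convergents of $\xi$. For any $k$ with $|Q_k| > |Bx_2/y_2|$ and any $\gamma\in\mathrm{SL}_2(\mathbb{F}_q[T])$ with $|\gamma| < |y_2Q_kQ_{k+1}/x_2|$, one has \[ |\gamma\underline{x} - \underline{y}| \geq \left|\frac{x_2}{BQ_k}\right|. \]
   Context: $\mathbb{F}_q((T^{-1}))$ is the field of formal Laurent series in $T^{-1}$ over the finite field $\mathbb{F}_q$ with absolute value $|x|=q^{\deg x}$, $|0|=0$; for vectors and matrices $|\cdot|$ is the maximum absolute value of the entries; $\mathrm{SL}_2(\mathbb{F}_q[T])$ acts on column vectors by multiplication. Convergents: $\xi=[A_0;A_1,\dots]$ is the continued fraction expansion ($A_i\in\mathbb{F}_q[T]$, $\deg A_i>0$ for $i\ge1$), $Q_{-2}=1,Q_{-1}=0$, $Q_n=A_nQ_{n-1}+Q_{n-2}$ and analogously $P_{-2}=0,P_{-1}=1$, $P_n=A_nP_{n-1}+P_{n-2}$. *)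

theory Defs
  imports "HOL-Analysis.Analysis" "HOL-Computational_Algebra.Formal_Laurent_Series"
begin

text \<open>
  The field \<open>F\<^sub>q((T\<^sup>-\<^sup>1))\<close> is \<^typ>\<open>'a fls\<close> with \<open>'a\<close> a finite field, \<open>q = CARD('a)\<close>. The formal
  variable \<^const>\<open>fls_X\<close> plays the role of \<open>T\<^sup>-\<^sup>1\<close>, so \<open>T\<close> is \<^const>\<open>fls_X_inv\<close>, the coefficient
  of \<open>T\<^sup>n\<close> is the one at index \<open>-n\<close>, and the degree in \<open>T\<close> is minus the subdegree.
\<close>

definition deg_T :: "'a::zero fls \<Rightarrow> int" where
  "deg_T x = - fls_subdegree x"

definition abs_T :: "'a::{field,finite} fls \<Rightarrow> real" where
  "abs_T x = (if x = 0 then 0 else real CARD('a) powi deg_T x)"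

definition of_poly_T :: "'a::field poly \<Rightarrow> 'a fls" where
  "of_poly_T p = poly (map_poly fls_const p) fls_X_inv"

definition rat_T :: "'a::field fls set" where
  "rat_T = {of_poly_T a / of_poly_T b | a b. b \<noteq> 0}"

definition vec_abs_T :: "'a::{field,finite} fls ^ 'n \<Rightarrow> real" where
  "vec_abs_T v = Max (range (\<lambda>i. abs_T (v $ i)))"

definition mat_abs_T :: "'a::{field,finite} fls ^ 'n ^ 'm \<Rightarrow> real" where
  "mat_abs_T M = Max (range (\<lambda>(i, j). abs_T (M $ i $ j)))"

definition SL2 :: "('a::comm_ring_1 ^ 2 ^ 2) set" where
  "SL2 = {\<gamma>. det \<gamma> = 1}"

text \<open>
  The part of a Laurent series that is polynomial in \<open>T\<close>; \<^const>\<open>fls_prpart\<close> omits the constant term.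
\<close>

definition poly_part_T :: "'a::field fls \<Rightarrow> 'a poly" where
  "poly_part_T x = fls_prpart x + [:fls_nth x 0:]"

primrec cf_complete :: "'a::field fls \<Rightarrow> nat \<Rightarrow> 'a fls" where
  "cf_complete \<xi> 0 = \<xi>"
| "cf_complete \<xi> (Suc n) =
     inverse (cf_complete \<xi> n - of_poly_T (poly_part_T (cf_complete \<xi> n)))"

definition cf_coeff :: "'a::field fls \<Rightarrow> nat \<Rightarrow> 'a poly" where
  "cf_coeff \<xi> n = poly_part_T (cf_complete \<xi> n)"

text \<open>
  The recurrences start at index \<open>-2\<close>: the \<open>n\<close>-th values of \<open>cf_P_shift\<close> and \<open>cf_Q_shift\<close> are
  \<open>P\<^bsub>n-2\<^esub>\<close> and \<open>Q\<^bsub>n-2\<^esub>\<close>.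
\<close>

fun cf_P_shift :: "'a::field fls \<Rightarrow> nat \<Rightarrow> 'a poly" where
  "cf_P_shift \<xi> 0 = 0"
| "cf_P_shift \<xi> (Suc 0) = 1"
| "cf_P_shift \<xi> (Suc (Suc n)) = cf_coeff \<xi> n * cf_P_shift \<xi> (Suc n) + cf_P_shift \<xi> n"

fun cf_Q_shift :: "'a::field fls \<Rightarrow> nat \<Rightarrow> 'a poly" where
  "cf_Q_shift \<xi> 0 = 1"
| "cf_Q_shift \<xi> (Suc 0) = 0"
| "cf_Q_shift \<xi> (Suc (Suc n)) = cf_coeff \<xi> n * cf_Q_shift \<xi> (Suc n) + cf_Q_shift \<xi> n"

definition cf_P :: "'a::field fls \<Rightarrow> nat \<Rightarrow> 'a poly" where
  "cf_P \<xi> n = cf_P_shift \<xi> (n + 2)"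

definition cf_Q :: "'a::field fls \<Rightarrow> nat \<Rightarrow> 'a poly" where
  "cf_Q \<xi> n = cf_Q_shift \<xi> (n + 2)"

lemma of_poly_T_0 [simp]: "of_poly_T 0 = 0"
  by (simp add: of_poly_T_def)

lemma of_poly_T_pCons: "of_poly_T (pCons a p) = fls_const a + fls_X_inv * of_poly_T p"
  by (cases "a = 0 \<and> p = 0") (auto simp: of_poly_T_def map_poly_pCons)

lemma of_poly_T_nth:
  "fls_nth (of_poly_T p) n = (if n \<le> 0 then coeff p (nat (- n)) else 0)"
proof (induction p arbitrary: n)
  case 0
  then show ?case by simp
next
  case (pCons a p)
  have "nat (- n) = Suc (nat (- (n + 1)))" if "n < 0"
    using that by linarith
  then show ?case
    by (auto simp: of_poly_T_pCons fls_X_inv_times_conv_shift pCons.IH coeff_pCons split: nat.splits)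
qed

lemma deg_T_of_poly: "deg_T (of_poly_T p) = int (degree p)"
proof (cases "p = 0")
  case True
  then show ?thesis by (simp add: deg_T_def)
next
  case False
  have "fls_subdegree (of_poly_T p) = - int (degree p)"
    using False by (intro fls_subdegree_eqI) (auto simp: of_poly_T_nth intro!: coeff_eq_0)
  then show ?thesis by (simp add: deg_T_def)
qed

lemma frac_part_nth:
  "fls_nth (x - of_poly_T (poly_part_T x)) n = (if n \<le> 0 then 0 else fls_nth x n)"
proof (cases "n < 0")
  case True
  then have "nat (- n) \<noteq> 0" by simp
  then show ?thesis
    using True by (auto simp: of_poly_T_nth poly_part_T_def coeff_pCons split: nat.splits)
next
  case False
  then show ?thesis
    by (cases "n = 0") (auto simp: of_poly_T_nth poly_part_T_def)
qed

lemma of_poly_T_eq_0_iff [simp]: "of_poly_T p = 0 \<longleftrightarrow> p = 0"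
proof
  assume "of_poly_T p = 0"
  then have "coeff p n = 0" for n
    using of_poly_T_nth[of p "- int n"] by simp
  then show "p = 0" by (simp add: poly_eq_iff)
qed simp

lemma of_poly_T_1 [simp]: "of_poly_T 1 = 1"
  by (simp add: of_poly_T_def)

lemma of_poly_T_add: "of_poly_T (p + q) = of_poly_T p + of_poly_T q"
  by (rule fls_eqI) (simp add: of_poly_T_nth)

lemma of_poly_T_mult: "of_poly_T (p * q) = of_poly_T p * of_poly_T q"
proof -
  have smult: "of_poly_T (Polynomial.smult a r) = fls_const a * of_poly_T r" for a r
    by (rule fls_eqI) (simp add: of_poly_T_nth)
  show ?thesis
    by (induction p) (simp_all add: of_poly_T_pCons of_poly_T_add smult algebra_simps)
qed

lemma cf_complete_irrational:
  assumes "\<xi> \<notin> rat_T"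
  shows "cf_complete \<xi> n \<notin> rat_T"
proof (induction n)
  case 0
  then show ?case using assms by simp
next
  case (Suc n)
  define z where "z = cf_complete \<xi> n"
  define c where "c = poly_part_T z"
  show ?case
  proof
    assume "cf_complete \<xi> (Suc n) \<in> rat_T"
    then obtain a b where ab: "b \<noteq> 0" "inverse (z - of_poly_T c) = of_poly_T a / of_poly_T b"
      by (auto simp: rat_T_def z_def c_def)
    then have eq: "z = of_poly_T c + of_poly_T b / of_poly_T a"
      by (metis add.commute diff_add_cancel inverse_divide inverse_inverse_eq)
    have "z \<in> rat_T"
    proof (cases "a = 0")
      case True
      then have "z = of_poly_T c / of_poly_T 1" using eq by simp
      then show ?thesis unfolding rat_T_def by (metis (mono_tags, lifting) mem_Collect_eq one_neq_zero)
    next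
      case False
      then have "z = of_poly_T (c * a + b) / of_poly_T a"
        using eq by (simp add: of_poly_T_add of_poly_T_mult field_simps)
      then show ?thesis using False unfolding rat_T_def by blast
    qed
    then show False using Suc z_def by simp
  qed
qed

lemma degree_cf_coeff_pos:
  assumes "\<xi> \<notin> rat_T"
  shows "degree (cf_coeff \<xi> (Suc n)) > 0"
proof -
  define z where "z = cf_complete \<xi> n"
  define f where "f = z - of_poly_T (poly_part_T z)"
  have "f \<noteq> 0"
  proof
    assume "f = 0"
    then have "z = of_poly_T (poly_part_T z) / of_poly_T 1" by (simp add: f_def)
    then have "z \<in> rat_T" unfolding rat_T_def
      by (metis (mono_tags, lifting) mem_Collect_eq one_neq_zero)
    then show False using cf_complete_irrational[OF assms] z_def by blast
  qed
  moreover have "fls_nth f m = 0" if "m < 1" for m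
    using that unfolding f_def frac_part_nth by simp
  ultimately have sub: "fls_subdegree f \<ge> 1"
    by (intro fls_subdegree_geI) auto
  define d where "d = nat (fls_subdegree f)"
  have d: "fls_subdegree (inverse f) = - int d" "d > 0"
    using sub by (auto simp: d_def fls_inverse_subdegree)
  have "fls_nth (inverse f) (- int d) \<noteq> 0"
    using d \<open>f \<noteq> 0\<close> by (metis nonzero_imp_inverse_nonzero nth_fls_subdegree_nonzero)
  moreover have "cf_coeff \<xi> (Suc n) = poly_part_T (inverse f)"
    by (simp add: cf_coeff_def f_def z_def)
  ultimately have "coeff (cf_coeff \<xi> (Suc n)) d \<noteq> 0"
    using d(2) by (auto simp: poly_part_T_def coeff_pCons split: nat.splits)
  then show ?thesis using d(2) le_degree by (metis less_le_trans)
qed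

end

theory Submission
  imports Defs
begin

no_notation fps_nth (infixl \<open>$\<close> 75)

text \<open>
  Write \<open>p = (P\<^sub>k, Q\<^sub>k)\<close>, let \<open>\<Lambda> = \<gamma>x - y\<close>, and suppose that \<open>\<Lambda>\<close> is too small. Since \<open>p\<close> is nearly
  proportional to \<open>x\<close>, the vector \<open>\<gamma>p\<close> is nearly proportional to \<open>y\<close>, hence to \<open>(A, B)\<close>. The
  determinant of \<open>(A, B)\<close> and \<open>\<gamma>p\<close> is a polynomial of absolute value less than \<open>1\<close>, so it vanishes,
  and as \<open>\<gamma>p\<close> generates the unit ideal, \<open>(\<gamma>p)\<^sub>2\<close> divides \<open>B\<close>. But \<open>(\<gamma>x)\<^sub>2\<close> is \<open>x\<^sub>2 (\<gamma>p)\<^sub>2 / Q\<^sub>k\<close>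
  up to an error smaller than \<open>|y\<^sub>2|\<close>, so \<open>|(\<gamma>x)\<^sub>2| < |y\<^sub>2|\<close> and \<open>|\<Lambda>\<^sub>2| = |y\<^sub>2|\<close>, which is too large.
\<close>

section \<open>The absolute value\<close>

lemma one_less_card_field: "real CARD('a::{field,finite}) > 1"
proof -
  have "card {0, 1 :: 'a} \<le> CARD('a)"
    by (intro card_mono) auto
  then show ?thesis by simp
qed

lemma abs_T_0 [simp]: "abs_T 0 = 0"
  by (simp add: abs_T_def)

lemma abs_T_1 [simp]: "abs_T 1 = 1"
  by (simp add: abs_T_def deg_T_def)

lemma abs_T_pos: "x \<noteq> 0 \<Longrightarrow> abs_T x > 0"
  for x :: "'a::{field,finite} fls"
  using one_less_card_field[where 'a='a] by (simp add: abs_T_def)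

lemma abs_T_nonneg [simp]: "abs_T x \<ge> 0"
  using abs_T_pos[of x] by (cases "x = 0") auto

lemma abs_T_mult: "abs_T (x * y) = abs_T x * abs_T y"
  for x y :: "'a::{field,finite} fls"
  using one_less_card_field[where 'a='a]
  by (auto simp: abs_T_def deg_T_def power_int_diff power_int_minus field_simps)

lemma abs_T_divide: "abs_T (x / y) = abs_T x / abs_T y"
proof (cases "y = 0")
  case False
  then have "abs_T (x / y) * abs_T y = abs_T x"
    by (simp flip: abs_T_mult)
  then show ?thesis
    using abs_T_pos[OF False] by (simp add: field_simps)
qed simp

lemma abs_T_minus [simp]: "abs_T (- x) = abs_T x"
  by (simp add: abs_T_def deg_T_def)

lemma abs_T_mono:
  fixes x y :: "'a::{field,finite} fls"
  assumes "y \<noteq> 0" and "deg_T x \<le> deg_T y"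
  shows "abs_T x \<le> abs_T y"
  using assms one_less_card_field[where 'a='a]
  by (auto simp: abs_T_def intro: power_int_increasing)

lemma abs_T_less_1_iff: "abs_T x < 1 \<longleftrightarrow> (\<forall>n\<le>0. fls_nth x n = 0)"
  for x :: "'a::{field,finite} fls"
proof (cases "x = 0")
  case False
  have "abs_T x < 1 \<longleftrightarrow> deg_T x < 0"
    using power_int_strict_increasing[of "deg_T x" 0 "real CARD('a)"]
      one_le_power_int[of "real CARD('a)" "deg_T x"] one_less_card_field[where 'a='a] False
    unfolding abs_T_def by (smt (verit) power_int_0_right)
  also have "\<dots> \<longleftrightarrow> fls_subdegree x \<ge> 1"
    by (auto simp: deg_T_def)
  also have "\<dots> \<longleftrightarrow> (\<forall>n\<le>0. fls_nth x n = 0)"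
    using False by (auto intro!: fls_subdegree_geI)
  finally show ?thesis .
qed simp

lemma abs_T_add_le: "abs_T (x + y) \<le> max (abs_T x) (abs_T y)"
proof (cases "x = 0 \<or> y = 0 \<or> x + y = 0")
  case False
  then have "min (fls_subdegree x) (fls_subdegree y) \<le> fls_subdegree (x + y)"
    by (intro fls_plus_subdegree) auto
  then have "deg_T (x + y) \<le> deg_T x \<or> deg_T (x + y) \<le> deg_T y"
    by (auto simp: deg_T_def min_def split: if_splits)
  then show ?thesis
    using False abs_T_mono by (metis le_max_iff_disj)
qed (auto simp: le_max_iff_disj)

lemma abs_T_diff_le: "abs_T (x - y) \<le> max (abs_T x) (abs_T y)"
  using abs_T_add_le[of x "- y"] by simp

lemma abs_T_add_eq_left:
  assumes "abs_T y < abs_T x"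
  shows "abs_T (x + y) = abs_T x"
  using abs_T_add_le[of x y] abs_T_diff_le[of "x + y" y] assms
  by (simp add: max_def split: if_splits)

lemma abs_T_le_vec_abs_T: "abs_T (v $ i) \<le> vec_abs_T v"
  unfolding vec_abs_T_def by (rule Max_ge) auto

lemma vec_abs_T_leI: "(\<And>i. abs_T (v $ i) \<le> c) \<Longrightarrow> vec_abs_T v \<le> c"
  unfolding vec_abs_T_def by (rule Max.boundedI) auto

lemma vec_abs_T_nonneg: "vec_abs_T v \<ge> 0"
  using abs_T_le_vec_abs_T abs_T_nonneg order_trans by blast

lemma vec_abs_T_column_le: "vec_abs_T (column j M) \<le> mat_abs_T M"
proof (rule vec_abs_T_leI)
  show "abs_T (column j M $ i) \<le> mat_abs_T M" for i
    unfolding mat_abs_T_def column_def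
    by (rule Max_ge) (auto intro: image_eqI[of _ _ "(i, j)"])
qed

section \<open>Polynomials as Laurent series\<close>

lemma of_poly_T_minus: "of_poly_T (- p) = - of_poly_T p"
  by (rule fls_eqI) (simp add: of_poly_T_nth)

lemma of_poly_T_diff: "of_poly_T (p - q) = of_poly_T p - of_poly_T q"
  using of_poly_T_add[of p "- q"] by (simp add: of_poly_T_minus)

lemma of_poly_T_sum: "of_poly_T (sum f S) = (\<Sum>i\<in>S. of_poly_T (f i))"
  by (induction S rule: infinite_finite_induct) (simp_all add: of_poly_T_add)

lemma abs_T_of_poly_T_mono:
  "q \<noteq> 0 \<Longrightarrow> degree p \<le> degree q \<Longrightarrow> abs_T (of_poly_T p) \<le> abs_T (of_poly_T q)"
  for p q :: "'a::{field,finite} poly"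
  by (rule abs_T_mono) (auto simp: deg_T_of_poly)

lemma abs_T_of_poly_T_less_1_iff: "abs_T (of_poly_T p) < 1 \<longleftrightarrow> p = 0"
  for p :: "'a::{field,finite} poly"
  using abs_T_of_poly_T_mono[of p 1] by fastforce

lemma abs_T_minus_poly_part_less_1: "abs_T (x - of_poly_T (poly_part_T x)) < 1"
  for x :: "'a::{field,finite} fls"
  unfolding abs_T_less_1_iff frac_part_nth by simp

definition of_poly_vec_T :: "'a::field poly ^ 'n \<Rightarrow> 'a fls ^ 'n" where
  "of_poly_vec_T v = (\<chi> i. of_poly_T (v $ i))"

lemma of_poly_vec_T_nth [simp]: "of_poly_vec_T v $ i = of_poly_T (v $ i)"
  by (simp add: of_poly_vec_T_def)

lemma of_poly_vec_T_matrix_vector_mult: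
  "of_poly_vec_T (M *v v) = map_matrix of_poly_T M *v of_poly_vec_T v"
  by (simp add: vec_eq_iff matrix_vector_mult_def map_matrix_def of_poly_T_sum of_poly_T_mult)

lemma map_matrix_of_poly_T_SL2: "\<gamma> \<in> SL2 \<Longrightarrow> map_matrix of_poly_T \<gamma> \<in> SL2"
  by (simp add: SL2_def det_2 map_matrix_def flip: of_poly_T_mult of_poly_T_diff)

section \<open>The determinant of two plane vectors\<close>

definition cross2 :: "'a::comm_ring_1 ^ 2 \<Rightarrow> 'a ^ 2 \<Rightarrow> 'a" where
  "cross2 v w = v $ 1 * w $ 2 - v $ 2 * w $ 1"

lemma cross2_matrix_vector_mult: "cross2 (M *v v) (M *v w) = det M * cross2 v w"
  by (simp add: cross2_def det_2 matrix_vector_mult_def sum_2 algebra_simps)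

lemma cross2_SL2: "M \<in> SL2 \<Longrightarrow> cross2 (M *v v) (M *v w) = cross2 v w"
  by (simp add: cross2_matrix_vector_mult SL2_def)

lemma cross2_of_poly_vec_T: "cross2 (of_poly_vec_T v) (of_poly_vec_T w) = of_poly_T (cross2 v w)"
  by (simp add: cross2_def of_poly_T_mult of_poly_T_diff)

lemma cross2_cramer: "cross2 v w *s u = cross2 u w *s v - cross2 u v *s w"
  by (simp add: vec_eq_iff forall_2 cross2_def algebra_simps)

lemma nth_dvd_nth_if_cross2_eq_0:
  fixes u v w :: "'a::comm_ring_1 ^ 2"
  assumes "cross2 v w dvd 1" and "cross2 u v = 0"
  shows "v $ i dvd u $ i"
proof -
  have "cross2 v w * u $ i = v $ i * cross2 u w"
    using cross2_cramer[of v w u] assms(2) by (simp add: vec_eq_iff mult.commute)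
  then have "v $ i dvd cross2 v w * u $ i"
    by simp
  also have "cross2 v w * u $ i dvd 1 * u $ i"
    using assms(1) by (intro mult_dvd_mono) auto
  finally show ?thesis by simp
qed

lemma abs_T_cross2_le: "abs_T (cross2 v w) \<le> vec_abs_T v * vec_abs_T w"
proof -
  have "abs_T (v $ i * w $ j) \<le> vec_abs_T v * vec_abs_T w" for i j
    by (simp add: abs_T_mult mult_mono abs_T_le_vec_abs_T vec_abs_T_nonneg)
  then show ?thesis
    unfolding cross2_def by (intro order_trans[OF abs_T_diff_le] max.boundedI)
qed

section \<open>Convergents\<close>

lemma degree_mult_add_eq:
  fixes a q r :: "'a::idom poly"
  assumes "degree a > 0" and "q \<noteq> 0" and "degree r \<le> degree q"
  shows "degree (a * q + r) = degree a + degree q"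
proof -
  have "degree (a * q) = degree a + degree q"
    using assms by (intro degree_mult_eq) auto
  then show ?thesis
    using assms by (subst degree_add_eq_left) auto
qed

lemma cf_Q_shift_degree_mono:
  assumes "\<xi> \<notin> rat_T"
  shows "cf_Q_shift \<xi> (n + 2) \<noteq> 0 \<and> degree (cf_Q_shift \<xi> (n + 1)) \<le> degree (cf_Q_shift \<xi> (n + 2))"
proof (induction n)
  case (Suc n)
  have "degree (cf_Q_shift \<xi> (Suc n + 2)) = degree (cf_coeff \<xi> (Suc n)) + degree (cf_Q_shift \<xi> (n + 2))"
    using degree_mult_add_eq[OF degree_cf_coeff_pos[OF assms]] Suc by simp
  then show ?case
    using degree_cf_coeff_pos[OF assms, of n] by auto
qed simp

lemma cf_Q_nonzero: "\<xi> \<notin> rat_T \<Longrightarrow> cf_Q \<xi> n \<noteq> 0"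
  using cf_Q_shift_degree_mono[of \<xi> n] by (simp add: cf_Q_def)

lemma abs_T_cf_Q_shift_mono:
  assumes "\<xi> \<notin> rat_T"
  shows "abs_T (of_poly_T (cf_Q_shift \<xi> (n + 1))) \<le> abs_T (of_poly_T (cf_Q_shift \<xi> (n + 2)))"
  using cf_Q_shift_degree_mono[OF assms, of n] by (intro abs_T_of_poly_T_mono) auto

lemma cf_shift_det:
  "cf_P_shift \<xi> (n + 1) * cf_Q_shift \<xi> n - cf_P_shift \<xi> n * cf_Q_shift \<xi> (n + 1) = (-1) ^ n"
  by (induction n) (simp_all add: algebra_simps)

lemma cf_complete_Suc_mult:
  assumes "\<xi> \<notin> rat_T"
  shows "cf_complete \<xi> (Suc n) * cf_complete \<xi> n = cf_complete \<xi> (Suc n) * of_poly_T (cf_coeff \<xi> n) + 1"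
proof -
  have "0 \<in> rat_T"
    unfolding rat_T_def by (metis (mono_tags, lifting) div_0 mem_Collect_eq of_poly_T_0 one_neq_zero)
  then have "cf_complete \<xi> (Suc n) \<noteq> 0"
    using cf_complete_irrational[OF assms] by metis
  then have "cf_complete \<xi> (Suc n) * (cf_complete \<xi> n - of_poly_T (cf_coeff \<xi> n)) = 1"
    by (simp add: cf_coeff_def)
  then show ?thesis
    by (simp add: algebra_simps)
qed

lemma cf_complete_moebius:
  assumes "\<xi> \<notin> rat_T"
  shows "\<xi> * (cf_complete \<xi> n * of_poly_T (cf_Q_shift \<xi> (n + 1)) + of_poly_T (cf_Q_shift \<xi> n))
    = cf_complete \<xi> n * of_poly_T (cf_P_shift \<xi> (n + 1)) + of_poly_T (cf_P_shift \<xi> n)"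
proof (induction n)
  case (Suc n)
  let ?z = "cf_complete \<xi> n" and ?z' = "cf_complete \<xi> (Suc n)" and ?a = "cf_coeff \<xi> n"
  have shift: "?z' * (?z * of_poly_T u + of_poly_T v) = ?z' * of_poly_T (?a * u + v) + of_poly_T u" for u v
  proof -
    have "?z' * (?z * of_poly_T u + of_poly_T v) = (?z' * ?z) * of_poly_T u + ?z' * of_poly_T v"
      by (simp only: algebra_simps)
    also have "\<dots> = (?z' * of_poly_T ?a + 1) * of_poly_T u + ?z' * of_poly_T v"
      by (simp only: cf_complete_Suc_mult[OF assms])
    also have "\<dots> = ?z' * of_poly_T (?a * u + v) + of_poly_T u"
      by (simp only: of_poly_T_add of_poly_T_mult algebra_simps mult_1)
    finally show ?thesis .
  qed
  show ?case
    using arg_cong[OF Suc, of "\<lambda>w. ?z' * w"]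
    by (simp only: mult.left_commute[of ?z' \<xi>] shift add_2_eq_Suc' Suc_eq_plus1[symmetric]
        cf_P_shift.simps cf_Q_shift.simps)
qed simp

lemma abs_T_cf_complete_denominator:
  assumes "\<xi> \<notin> rat_T"
  shows "abs_T (cf_complete \<xi> n * of_poly_T (cf_Q_shift \<xi> (n + 1)) + of_poly_T (cf_Q_shift \<xi> n))
    = abs_T (of_poly_T (cf_Q_shift \<xi> (n + 2)))"
proof -
  define f where "f = cf_complete \<xi> n - of_poly_T (cf_coeff \<xi> n)"
  let ?q = "of_poly_T (cf_Q_shift \<xi> (n + 1))" and ?q' = "of_poly_T (cf_Q_shift \<xi> (n + 2))"
  have "cf_complete \<xi> n * ?q + of_poly_T (cf_Q_shift \<xi> n) = ?q' + f * ?q"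
    by (simp add: f_def of_poly_T_add of_poly_T_mult algebra_simps)
  moreover have "abs_T (f * ?q) < abs_T ?q'"
  proof (cases "?q = 0")
    case True
    then show ?thesis
      using cf_Q_shift_degree_mono[OF assms, of n] by (simp add: abs_T_pos)
  next
    case False
    have "abs_T f < 1"
      using abs_T_minus_poly_part_less_1 by (simp add: f_def cf_coeff_def)
    then have "abs_T (f * ?q) < abs_T ?q"
      using abs_T_pos[OF False] by (simp add: abs_T_mult)
    also have "\<dots> \<le> abs_T ?q'"
      by (rule abs_T_cf_Q_shift_mono[OF assms])
    finally show ?thesis .
  qed
  ultimately show ?thesis
    by (simp add: abs_T_add_eq_left)
qed

lemma abs_T_cf_error:
  assumes "\<xi> \<notin> rat_T"
  shows "abs_T (of_poly_T (cf_Q \<xi> k) * \<xi> - of_poly_T (cf_P \<xi> k))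
    = 1 / abs_T (of_poly_T (cf_Q \<xi> (k + 1)))"
proof -
  define z where "z = cf_complete \<xi> (k + 1)"
  define p q p' q' where "p = of_poly_T (cf_P \<xi> k)" and "q = of_poly_T (cf_Q \<xi> k)"
    and "p' = of_poly_T (cf_P_shift \<xi> (k + 1))" and "q' = of_poly_T (cf_Q_shift \<xi> (k + 1))"
  have "(q * \<xi> - p) * (z * q + q') = q * (\<xi> * (z * q + q')) - p * (z * q + q')"
    by (simp only: algebra_simps)
  also have "\<dots> = q * (z * p + p') - p * (z * q + q')"
    using cf_complete_moebius[OF assms, of "k + 1"]
    by (simp add: p_def q_def p'_def q'_def z_def cf_P_def cf_Q_def)
  also have "\<dots> = - of_poly_T (cf_P \<xi> k * cf_Q_shift \<xi> (k + 1) - cf_P_shift \<xi> (k + 1) * cf_Q \<xi> k)"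
    by (simp add: p_def q_def p'_def q'_def of_poly_T_diff of_poly_T_mult algebra_simps)
  also have "\<dots> = - of_poly_T ((-1) ^ (k + 1))"
    using cf_shift_det[of \<xi> "k + 1"] by (simp add: cf_P_def cf_Q_def)
  finally have "abs_T (q * \<xi> - p) * abs_T (z * q + q') = abs_T (of_poly_T ((-1) ^ (k + 1) :: 'a poly))"
    by (metis abs_T_minus abs_T_mult)
  also have "\<dots> = 1"
    by (cases "even k") (simp_all add: of_poly_T_minus)
  also have "abs_T (z * q + q') = abs_T (of_poly_T (cf_Q \<xi> (k + 1)))"
    using abs_T_cf_complete_denominator[OF assms, of "k + 1"] by (simp add: q_def q'_def z_def cf_Q_def)
  finally show ?thesis
    using cf_Q_nonzero[OF assms, of "k + 1"] abs_T_pos[of "of_poly_T (cf_Q \<xi> (k + 1))"]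
    by (simp add: p_def q_def nonzero_eq_divide_eq)
qed

lemma abs_T_cf_Q_mono:
  "\<xi> \<notin> rat_T \<Longrightarrow> abs_T (of_poly_T (cf_Q \<xi> k)) \<le> abs_T (of_poly_T (cf_Q \<xi> (k + 1)))"
  using abs_T_cf_Q_shift_mono[of \<xi> "k + 1"] by (simp add: cf_Q_def)

definition convergent_vec :: "'a::field fls \<Rightarrow> nat \<Rightarrow> 'a poly ^ 2" where
  "convergent_vec \<xi> k = vector [cf_P \<xi> k, cf_Q \<xi> k]"

lemma convergent_vec_nth [simp]:
  "convergent_vec \<xi> k $ 1 = cf_P \<xi> k" "convergent_vec \<xi> k $ 2 = cf_Q \<xi> k"
  by (simp_all add: convergent_vec_def)

lemma cross2_convergent_vec_dvd_1:
  "cross2 (convergent_vec \<xi> k) (vector [cf_P_shift \<xi> (k + 1), cf_Q_shift \<xi> (k + 1)]) dvd 1"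
proof -
  have "cross2 (convergent_vec \<xi> k) (vector [cf_P_shift \<xi> (k + 1), cf_Q_shift \<xi> (k + 1)])
      = (-1) ^ (k + 1)"
    using cf_shift_det[of \<xi> "k + 1"] by (simp add: cross2_def cf_P_def cf_Q_def mult.commute)
  then show ?thesis
    by (cases "even k") simp_all
qed

lemma abs_T_cross2_convergent_vec:
  assumes "\<xi> \<notin> rat_T" and "x $ 2 \<noteq> 0" and "\<xi> = x $ 1 / x $ 2"
  shows "abs_T (cross2 x (of_poly_vec_T (convergent_vec \<xi> k)))
    = abs_T (x $ 2) / abs_T (of_poly_T (cf_Q \<xi> (k + 1)))"
proof -
  have "x $ 1 = \<xi> * x $ 2"
    using assms(2,3) by simp
  then have "cross2 x (of_poly_vec_T (convergent_vec \<xi> k))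
      = x $ 2 * (of_poly_T (cf_Q \<xi> k) * \<xi> - of_poly_T (cf_P \<xi> k))"
    by (simp add: cross2_def algebra_simps)
  then show ?thesis
    using abs_T_cf_error[OF assms(1)] by (simp add: abs_T_mult)
qed

section \<open>The lower bound\<close>

lemma matrix_vector_mult_cross2:
  fixes M :: "'a::comm_ring_1 ^ 2 ^ 'n"
  shows "x $ 2 *s (M *v p) = p $ 2 *s (M *v x) - cross2 x p *s column 1 M"
  by (simp add: vec_eq_iff matrix_vector_mult_def column_def cross2_def sum_2 algebra_simps)

lemma abs_T_matrix_vector_mult_nth_le:
  "abs_T (p $ 2) * abs_T ((M *v x) $ i)
    \<le> max (abs_T (x $ 2) * abs_T ((M *v p) $ i)) (abs_T (cross2 x p) * mat_abs_T M)"
proof -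
  have "p $ 2 * (M *v x) $ i = x $ 2 * (M *v p) $ i + cross2 x p * column 1 M $ i"
    using matrix_vector_mult_cross2[of x M p] by (simp add: vec_eq_iff)
  then have "abs_T (p $ 2) * abs_T ((M *v x) $ i)
      \<le> max (abs_T (x $ 2) * abs_T ((M *v p) $ i)) (abs_T (cross2 x p) * abs_T (column 1 M $ i))"
    by (metis abs_T_add_le abs_T_mult)
  also have "\<dots> \<le> max (abs_T (x $ 2) * abs_T ((M *v p) $ i)) (abs_T (cross2 x p) * mat_abs_T M)"
    by (intro max.mono mult_left_mono order_refl order_trans[OF abs_T_le_vec_abs_T vec_abs_T_column_le]) auto
  finally show ?thesis .
qed

lemma abs_T_cross2_column_le:
  assumes "M \<in> SL2"
  shows "abs_T (cross2 y (column 1 M)) \<le> max (abs_T (x $ 2)) (vec_abs_T (M *v x - y) * mat_abs_T M)"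
proof -
  have "M *v axis 1 1 = column 1 M"
    by (simp add: vec_eq_iff matrix_vector_mult_def column_def axis_def sum_2)
  then have "cross2 (M *v x) (column 1 M) = - x $ 2"
    using cross2_SL2[OF assms, of x "axis 1 1"] by (simp add: cross2_def axis_def)
  then have "cross2 y (column 1 M) = - x $ 2 - cross2 (M *v x - y) (column 1 M)"
    by (simp add: cross2_def algebra_simps)
  then have "abs_T (cross2 y (column 1 M)) \<le> max (abs_T (x $ 2)) (abs_T (cross2 (M *v x - y) (column 1 M)))"
    by (metis abs_T_diff_le abs_T_minus)
  also have "abs_T (cross2 (M *v x - y) (column 1 M)) \<le> vec_abs_T (M *v x - y) * mat_abs_T M"
    using abs_T_cross2_le vec_abs_T_column_le vec_abs_T_nonneg by (meson mult_left_mono order_trans)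
  finally show ?thesis
    by (simp add: max.mono)
qed

lemma abs_T_cross2_matrix_vector_mult_le:
  assumes "M \<in> SL2"
  shows "abs_T (x $ 2) * abs_T (cross2 y (M *v p))
    \<le> max (abs_T (p $ 2) * (vec_abs_T y * vec_abs_T (M *v x - y)))
        (abs_T (cross2 x p) * max (abs_T (x $ 2)) (vec_abs_T (M *v x - y) * mat_abs_T M))"
proof -
  have "x $ 2 * cross2 y (M *v p) = cross2 y (x $ 2 *s (M *v p))"
    by (simp add: cross2_def algebra_simps)
  also have "\<dots> = p $ 2 * cross2 y (M *v x - y) - cross2 x p * cross2 y (column 1 M)"
    unfolding matrix_vector_mult_cross2[of x M p] by (simp add: cross2_def[of y] algebra_simps)
  finally have "abs_T (x $ 2) * abs_T (cross2 y (M *v p))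
      \<le> max (abs_T (p $ 2) * abs_T (cross2 y (M *v x - y)))
          (abs_T (cross2 x p) * abs_T (cross2 y (column 1 M)))"
    by (metis abs_T_diff_le abs_T_mult)
  also have "\<dots> \<le> max (abs_T (p $ 2) * (vec_abs_T y * vec_abs_T (M *v x - y)))
      (abs_T (cross2 x p) * max (abs_T (x $ 2)) (vec_abs_T (M *v x - y) * mat_abs_T M))"
    by (intro max.mono mult_left_mono abs_T_cross2_le abs_T_cross2_column_le assms) auto
  finally show ?thesis .
qed

text \<open>
  For \<open>\<xi> = x\<^sub>1 / x\<^sub>2\<close> one has \<open>cross2 x p = x\<^sub>2 (p\<^sub>2 \<xi> - p\<^sub>1)\<close>, so that \<open>approx\<close> says
  \<open>|p\<^sub>2| |p\<^sub>2 \<xi> - p\<^sub>1| \<le> 1\<close>.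
\<close>

locale SL2_approximation =
  fixes x y :: "'a::{field,finite} fls ^ 2" and \<gamma> :: "'a poly ^ 2 ^ 2" and p \<eta> :: "'a poly ^ 2"
  assumes x2_nonzero: "x $ 2 \<noteq> 0" and y2_nonzero: "y $ 2 \<noteq> 0"
    and p2_nonzero: "p $ 2 \<noteq> 0" and \<eta>2_nonzero: "\<eta> $ 2 \<noteq> 0"
    and y_le: "abs_T (y $ 1) \<le> abs_T (y $ 2)"
    and y_parallel: "cross2 y (of_poly_vec_T \<eta>) = 0"
    and \<gamma>_SL2: "\<gamma> \<in> SL2"
    and approx: "abs_T (cross2 x (of_poly_vec_T p)) * abs_T (of_poly_T (p $ 2)) \<le> abs_T (x $ 2)"
    and height: "abs_T (of_poly_T (\<eta> $ 2)) * abs_T (x $ 2) < abs_T (y $ 2) * abs_T (of_poly_T (p $ 2))"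
    and size: "abs_T (cross2 x (of_poly_vec_T p)) * mat_abs_T (map_matrix of_poly_T \<gamma>)
      < abs_T (y $ 2) * abs_T (of_poly_T (p $ 2))"
begin

abbreviation G :: "'a fls ^ 2 ^ 2" where "G \<equiv> map_matrix of_poly_T \<gamma>"
abbreviation X :: real where "X \<equiv> abs_T (x $ 2)"
abbreviation Y :: real where "Y \<equiv> abs_T (y $ 2)"
abbreviation b :: real where "b \<equiv> abs_T (of_poly_T (\<eta> $ 2))"
abbreviation Q :: real where "Q \<equiv> abs_T (of_poly_T (p $ 2))"
abbreviation \<delta> :: real where "\<delta> \<equiv> abs_T (cross2 x (of_poly_vec_T p))"
abbreviation \<epsilon> :: real where "\<epsilon> \<equiv> vec_abs_T (G *v x - y)"

lemma abs_pos: "X > 0" "Y > 0" "b > 0" "Q > 0"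
  using x2_nonzero y2_nonzero \<eta>2_nonzero p2_nonzero by (simp_all add: abs_T_pos)

lemma abs_T_cross2_image_less:
  assumes close: "b * Q * \<epsilon> < X"
  shows "b * abs_T (cross2 y (G *v of_poly_vec_T p)) < Y"
proof -
  have "abs_T (y $ i) \<le> Y" for i
    using y_le exhaust_2[of i] by auto
  then have "vec_abs_T y \<le> Y"
    by (rule vec_abs_T_leI)
  then have "b * (Q * (vec_abs_T y * \<epsilon>)) \<le> b * (Q * (Y * \<epsilon>))"
    by (intro mult_left_mono mult_right_mono) (auto simp: vec_abs_T_nonneg)
  also have "\<dots> < X * Y"
    using mult_strict_right_mono[OF close abs_pos(2)] by (simp add: mult_ac)
  finally have "b * (Q * (vec_abs_T y * \<epsilon>)) < X * Y" .
  moreover have "b * (\<delta> * X) < X * Y"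
  proof -
    have "b * \<delta> * Q \<le> b * X"
      using mult_left_mono[OF approx, of b] by (simp add: mult_ac)
    also have "\<dots> < Y * Q"
      by (rule height)
    finally have "b * \<delta> < Y"
      using abs_pos by simp
    then show ?thesis
      using abs_pos by (simp add: mult_ac)
  qed
  moreover have "b * (\<delta> * (\<epsilon> * mat_abs_T G)) < X * Y"
  proof -
    have "b * (\<delta> * (\<epsilon> * mat_abs_T G)) = (b * \<epsilon>) * (\<delta> * mat_abs_T G)"
      by simp
    also have "\<dots> \<le> (b * \<epsilon>) * (Y * Q)"
      using size by (intro mult_left_mono) (auto simp: vec_abs_T_nonneg)
    also have "\<dots> < X * Y"
      using mult_strict_right_mono[OF close abs_pos(2)] by (simp add: mult_ac)
    finally show ?thesis .
  qed
  ultimately have "b * max (Q * (vec_abs_T y * \<epsilon>)) (\<delta> * max X (\<epsilon> * mat_abs_T G)) < X * Y"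
    by (simp add: max_def)
  moreover have "X * (b * abs_T (cross2 y (G *v of_poly_vec_T p)))
      \<le> b * max (Q * (vec_abs_T y * \<epsilon>)) (\<delta> * max X (\<epsilon> * mat_abs_T G))"
    using abs_T_cross2_matrix_vector_mult_le[OF map_matrix_of_poly_T_SL2[OF \<gamma>_SL2], of x y "of_poly_vec_T p"]
    by (simp add: mult.left_commute[of X] mult_left_mono)
  ultimately have "X * (b * abs_T (cross2 y (G *v of_poly_vec_T p))) < X * Y"
    by linarith
  then show ?thesis
    using abs_pos by simp
qed

lemma cross2_image_eq_0:
  assumes "b * Q * \<epsilon> < X"
  shows "cross2 \<eta> (\<gamma> *v p) = 0"
proof -
  have "of_poly_T (\<eta> $ 2) * cross2 y (G *v of_poly_vec_T p)
      = y $ 2 * cross2 (of_poly_vec_T \<eta>) (G *v of_poly_vec_T p)"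
    using y_parallel by (simp add: cross2_def algebra_simps)
  also have "\<dots> = y $ 2 * of_poly_T (cross2 \<eta> (\<gamma> *v p))"
    by (simp flip: of_poly_vec_T_matrix_vector_mult cross2_of_poly_vec_T)
  finally have "Y * abs_T (of_poly_T (cross2 \<eta> (\<gamma> *v p))) < Y"
    using abs_T_cross2_image_less[OF assms] by (metis abs_T_mult)
  then show ?thesis
    using abs_pos by (simp add: abs_T_of_poly_T_less_1_iff)
qed

lemma abs_T_image_nth_less:
  assumes "(\<gamma> *v p) $ 2 dvd \<eta> $ 2"
  shows "abs_T ((G *v x) $ 2) < Y"
proof -
  have "abs_T (of_poly_T ((\<gamma> *v p) $ 2)) \<le> b"
    using assms \<eta>2_nonzero by (intro abs_T_of_poly_T_mono dvd_imp_degree_le)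
  then have "X * abs_T ((G *v of_poly_vec_T p) $ 2) \<le> X * b"
    by (simp add: mult_left_mono flip: of_poly_vec_T_matrix_vector_mult)
  also have "\<dots> < Y * Q"
    using height by (simp add: mult.commute)
  finally have "Q * abs_T ((G *v x) $ 2) < Q * Y"
    using abs_T_matrix_vector_mult_nth_le[of "of_poly_vec_T p" G x 2] size by (simp add: mult.commute)
  then show ?thesis
    using abs_pos by simp
qed

lemma vec_abs_T_SL2_diff_ge:
  assumes "cross2 p q dvd 1"
  shows "X / (b * Q) \<le> \<epsilon>"
proof (rule ccontr)
  assume "\<not> X / (b * Q) \<le> \<epsilon>"
  then have close: "b * Q * \<epsilon> < X"
    using abs_pos by (simp add: field_simps)
  have "cross2 (\<gamma> *v p) (\<gamma> *v q) dvd 1"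
    using assms \<gamma>_SL2 by (simp add: cross2_SL2)
  then have "(\<gamma> *v p) $ 2 dvd \<eta> $ 2"
    using cross2_image_eq_0[OF close] nth_dvd_nth_if_cross2_eq_0 by blast
  then have "abs_T ((G *v x) $ 2) < Y"
    by (rule abs_T_image_nth_less)
  then have "Y = abs_T ((G *v x - y) $ 2)"
    using abs_T_add_eq_left[of "(G *v x) $ 2" "- y $ 2"] by (simp add: add.commute)
  then have "Y \<le> \<epsilon>"
    using abs_T_le_vec_abs_T[of "G *v x - y" 2] by simp
  have "b \<ge> 1"
    using \<eta>2_nonzero abs_T_of_poly_T_less_1_iff not_less by blast
  have "X \<le> b * X"
    using \<open>b \<ge> 1\<close> mult_right_mono[of 1 b X] by simp
  also have "\<dots> < Y * Q"
    by (rule height)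
  also have "\<dots> \<le> \<epsilon> * Q"
    using \<open>Y \<le> \<epsilon>\<close> by (simp add: mult_right_mono)
  also have "\<dots> \<le> b * (\<epsilon> * Q)"
    using \<open>b \<ge> 1\<close> mult_right_mono[of 1 b "\<epsilon> * Q"] by (simp add: vec_abs_T_nonneg)
  finally show False
    using close by (simp add: mult_ac)
qed

end

theorem theorem4p6:
  fixes x y :: "'a::{field,finite} fls ^ 2"
    and A B :: "'a poly" and k :: nat and \<gamma> :: "'a poly ^ 2 ^ 2" and \<xi> :: "'a fls"
  assumes "x $ 2 \<noteq> 0" and "y $ 2 \<noteq> 0"
    and "abs_T (x $ 1) \<le> abs_T (x $ 2)" and "abs_T (y $ 1) \<le> abs_T (y $ 2)"
    and "\<xi> = x $ 1 / x $ 2" and "\<xi> \<notin> rat_T"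
    and "y $ 1 / y $ 2 \<in> rat_T"
    and "B \<noteq> 0" and "coprime A B" and "y $ 1 / y $ 2 = of_poly_T A / of_poly_T B"
    and "abs_T (of_poly_T (cf_Q \<xi> k)) > abs_T (of_poly_T B * x $ 2 / y $ 2)"
    and "\<gamma> \<in> SL2"
    and "mat_abs_T (map_matrix of_poly_T \<gamma>)
           < abs_T (y $ 2 * of_poly_T (cf_Q \<xi> k) * of_poly_T (cf_Q \<xi> (k + 1)) / x $ 2)"
  shows "vec_abs_T (map_matrix of_poly_T \<gamma> *v x - y)
           \<ge> abs_T (x $ 2 / (of_poly_T B * of_poly_T (cf_Q \<xi> k)))"
proof -
  define p \<eta> where "p = convergent_vec \<xi> k" and "\<eta> = (vector [A, B] :: 'a poly ^ 2)"
  let ?Q = "of_poly_T (cf_Q \<xi> k)" and ?Q' = "of_poly_T (cf_Q \<xi> (k + 1))"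
  have [simp]: "p $ 2 = cf_Q \<xi> k" "\<eta> $ 1 = A" "\<eta> $ 2 = B"
    by (simp_all add: p_def \<eta>_def)
  have pos: "abs_T ?Q' > 0" "abs_T (x $ 2) > 0" "abs_T (y $ 2) > 0"
    using assms(1,2) cf_Q_nonzero[OF \<open>\<xi> \<notin> rat_T\<close>] by (simp_all add: abs_T_pos)
  have error: "abs_T (cross2 x (of_poly_vec_T p)) = abs_T (x $ 2) / abs_T ?Q'"
    unfolding p_def by (rule abs_T_cross2_convergent_vec[OF assms(6,1,5)])
  have "cross2 y (of_poly_vec_T \<eta>) = 0"
    using assms(2,8,10) by (simp add: cross2_def field_simps)
  moreover have "abs_T (x $ 2) / abs_T ?Q' * abs_T ?Q \<le> abs_T (x $ 2)"
    using abs_T_cf_Q_mono[OF \<open>\<xi> \<notin> rat_T\<close>, of k] pos by (simp add: field_simps)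
  moreover have "abs_T (of_poly_T B) * abs_T (x $ 2) < abs_T (y $ 2) * abs_T ?Q"
    using assms(11) pos by (simp add: abs_T_mult abs_T_divide field_simps)
  moreover have "abs_T (x $ 2) / abs_T ?Q' * mat_abs_T (map_matrix of_poly_T \<gamma>)
      < abs_T (y $ 2) * abs_T ?Q"
    using assms(13) pos by (simp add: abs_T_mult abs_T_divide field_simps)
  ultimately interpret SL2_approximation x y \<gamma> p \<eta>
    using assms(1,2,4,8,12) cf_Q_nonzero[OF \<open>\<xi> \<notin> rat_T\<close>]
    by unfold_locales (simp_all add: error)
  show ?thesis
    using vec_abs_T_SL2_diff_ge cross2_convergent_vec_dvd_1[of \<xi> k]
    unfolding p_def[symmetric] by (simp add: abs_T_mult abs_T_divide)
qed

end
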